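(* The following five pairs of lattice rectangles are amicable: (i) $1$-by-$34$ and $7$-by-$10$; (ii) $1$-by-$38$ and $6$-by-$13$; (iii) $1$-by-$54$ and $5$-by-$22$; (iv) $2$-by-$10$ and $4$-by-$6$; (v) $2$-by-$13$ and $3$-by-$10$. These are the only amicable lattice rectangles: if $R_1$ and $R_2$ are non-congruent lattice rectangles such that $(R_1,R_2)$ is amicable, then, up to congruence and up to exchanging $R_1$ and $R_2$, the pair $(R_1,R_2)$ is one of the five pairs listed.
   Context: All rectangles are (non-degenerate) rectangles in the Euclidean plane $\mathbb{R}^2$. A lattice rectangle is a rectangle all of whose vertices lie in the integer lattice $\mathbb{Z}^2$ (its sides are not required to be parallel to the coordinate axes). An $a$-by-$b$ rectangle is a rectangle with side lengths $a$ and $b$. Two polygons are amicable if the area of the first equals the perimeter of the second and the perimeter of the first equals the area of the second. It is a standing assumption that the two polygons of an amicable pair are not the same, i.e. not congruent. Congruent means related by an isometry of $\mathbb{R}^2$; each rectangle of a pair may be moved independently. *)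

theory Defs
  imports "HOL-Analysis.Analysis"
begin

text \<open>Plane figures are closed regions, i.e. subsets of \<^typ>\<open>real^2\<close>.\<close>

definition rectangle_by :: "real \<Rightarrow> real \<Rightarrow> (real^2) set \<Rightarrow> bool" where
  "rectangle_by a b R \<longleftrightarrow> a > 0 \<and> b > 0 \<and>
     (\<exists>A B C D. R = convex hull {A, B, C, D} \<and>
        C - D = B - A \<and> orthogonal (B - A) (D - A) \<and>
        dist A B = a \<and> dist A D = b)"

definition rectangle :: "(real^2) set \<Rightarrow> bool" where
  "rectangle R \<longleftrightarrow> (\<exists>a b. rectangle_by a b R)"

text \<open>The vertices of a convex polygon are its extreme points, and its sides are its
  one-dimensional faces; the length of a side is its diameter as a set.\<close>

definition lattice_rectangle :: "(real^2) set \<Rightarrow> bool" where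
  "lattice_rectangle R \<longleftrightarrow> rectangle R \<and> (\<forall>x. x extreme_point_of R \<longrightarrow> (\<forall>i. x $ i \<in> \<int>))"

definition area :: "(real^2) set \<Rightarrow> real" where
  "area P = measure lebesgue P"

definition perimeter :: "(real^2) set \<Rightarrow> real" where
  "perimeter P = (\<Sum>e\<in>{e. e edge_of P}. diameter e)"

definition congruent_figures :: "(real^2) set \<Rightarrow> (real^2) set \<Rightarrow> bool" where
  "congruent_figures P Q \<longleftrightarrow>
     (\<exists>f. (\<forall>x y. dist (f x) (f y) = dist x y) \<and> f ` P = Q)"

definition amicable :: "(real^2) set \<Rightarrow> (real^2) set \<Rightarrow> bool" where
  "amicable P Q \<longleftrightarrow> \<not> congruent_figures P Q \<and> area P = perimeter Q \<and> perimeter P = area Q"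

definition listed_pairs :: "((real \<times> real) \<times> (real \<times> real)) set" where
  "listed_pairs =
     {((1, 34), (7, 10)),
      ((1, 38), (6, 13)),
      ((1, 54), (5, 22)),
      ((2, 10), (4, 6)),
      ((2, 13), (3, 10))}"

end

theory Submission imports Defs begin

text \<open>A rectangle with sides a, b has area ab and perimeter 2(a + b), so being amicable to one
  with sides c, d means ab = 2(c + d) and cd = 2(a + b). A tilted lattice rectangle may have
  irrational sides, but its area is the absolute value of an integer determinant
  (\<open>lattice_rectangle_area_Ints\<close>). Hence each perimeter, being the other area, is an
  integer. As a * a and b * b are integers as well, rationality of a + b forces both sides to be
  integers (\<open>lattice_rectangle_sides_Ints\<close>).

  What remains is a Diophantine system with few solutions (\<open>amicable_sides_ordered\<close>),
  where a = c, b = d is ruled out by non-congruence. Conversely, the listed sides solve the system,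
  and the areas in each pair differ, so the rectangles are not congruent.

  Area is Lebesgue measure and perimeter a sum over one-dimensional faces; both are computed on an
  axis-parallel box and transported by isometries (\<open>area_rectangle\<close>,
  \<open>perimeter_rectangle\<close>).\<close>

section \<open>The normal form of a rectangle\<close>

text \<open>Congruence in a form suited to transport: measure, convex hulls and faces are all known
  to behave well under orthogonal maps and translations.\<close>

definition isometric_image :: "(real^2) set \<Rightarrow> (real^2) set \<Rightarrow> bool" where
  "isometric_image S R \<longleftrightarrow>
     (\<exists>t f. orthogonal_transformation f \<and> R = (+) t ` f ` S)"

abbreviation vec2 :: "real \<Rightarrow> real \<Rightarrow> real^2" where
  "vec2 x y \<equiv> vector [x, y]"

definition corners :: "real \<Rightarrow> real \<Rightarrow> (real^2) set" where
  "corners a b = {vec2 0 0, vec2 a 0, vec2 a b, vec2 0 b}"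

lemma vec2_eq_iff [simp]: "vec2 x y = vec2 x' y' \<longleftrightarrow> x = x' \<and> y = y'"
  by (metis vector_2)

lemma rectangle_by_pos:
  assumes "rectangle_by a b R"
  shows "a > 0" "b > 0"
  using assms by (simp_all add: rectangle_by_def)

lemma rectangle_by_cases:
  assumes "rectangle_by a b R"
  obtains A u v where "u \<bullet> v = 0" "norm u = a" "norm v = b" "a > 0" "b > 0"
    "R = convex hull {A, A + u, A + u + v, A + v}"
proof -
  from assms obtain A B C D where R: "R = convex hull {A, B, C, D}"
    and *: "C - D = B - A" "orthogonal (B - A) (D - A)" "dist A B = a" "dist A D = b"
    and ab: "a > 0" "b > 0"
    unfolding rectangle_by_def by blast
  have "C = D + B - A"
    using *(1) by (simp add: algebra_simps)
  show thesis
  proof (rule that[of "B - A" "D - A" A])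
    show "R = convex hull {A, A + (B - A), A + (B - A) + (D - A), A + (D - A)}"
      by (simp add: R \<open>C = D + B - A\<close> algebra_simps)
  qed (use * ab in \<open>auto simp: orthogonal_def dist_norm norm_minus_commute\<close>)
qed

lemma rectangle_by_intro:
  assumes "u \<bullet> v = 0" "norm u > 0" "norm v > 0"
  shows "rectangle_by (norm u) (norm v) (convex hull {A, A + u, A + u + v, A + v})"
  unfolding rectangle_by_def
  using assms
  by (intro conjI exI[of _ A] exI[of _ "A + u"] exI[of _ "A + u + v"] exI[of _ "A + v"])
     (auto simp: orthogonal_def dist_norm)

lemma rectangle_by_commute: "rectangle_by a b R \<Longrightarrow> rectangle_by b a R"
proof -
  assume "rectangle_by a b R"
  then obtain A u v where *: "u \<bullet> v = 0" "norm u = a" "norm v = b" "a > 0" "b > 0"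
    and R: "R = convex hull {A, A + u, A + u + v, A + v}"
    by (rule rectangle_by_cases)
  have "{A, A + u, A + u + v, A + v} = {A, A + v, A + v + u, A + u}"
    by (auto simp: ac_simps)
  with rectangle_by_intro[of v u A] * R show ?thesis
    by (simp add: inner_commute)
qed

text \<open>The map sends the standard basis to the orthonormal pair u/a, v/b.\<close>

lemma orthogonal_frame:
  fixes u v :: "real^2"
  assumes "u \<bullet> v = 0" "norm u = a" "norm v = b" "a > 0" "b > 0"
  shows "orthogonal_transformation (\<lambda>x::real^2. (x$1 / a) *\<^sub>R u + (x$2 / b) *\<^sub>R v)"
    (is "orthogonal_transformation ?f")
  unfolding orthogonal_transformation_def
proof
  show "linear ?f"
    by (intro linearI) (auto simp: algebra_simps add_divide_distrib scaleR_add_left)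
  have uu: "u \<bullet> u = a\<^sup>2" "v \<bullet> v = b\<^sup>2" "v \<bullet> u = 0"
    using assms by (auto simp: power2_norm_eq_inner inner_commute)
  have frame: "(p *\<^sub>R u + q *\<^sub>R v) \<bullet> (r *\<^sub>R u + s *\<^sub>R v) = p * r * a\<^sup>2 + q * s * b\<^sup>2" for p q r s
    using assms(1) uu by (simp add: inner_add_left inner_add_right)
  show "\<forall>x y. ?f x \<bullet> ?f y = x \<bullet> y"
    unfolding frame using assms(4,5) by (simp add: inner_vec_def sum_2 power2_eq_square)
qed

lemma rectangle_by_isometric_corners:
  assumes "rectangle_by a b R"
  shows "isometric_image (convex hull (corners a b)) R"
proof -
  from assms obtain A u v where *: "u \<bullet> v = 0" "norm u = a" "norm v = b" "a > 0" "b > 0"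
    and R: "R = convex hull {A, A + u, A + u + v, A + v}"
    by (rule rectangle_by_cases)
  define f where "f = (\<lambda>x::real^2. (x$1 / a) *\<^sub>R u + (x$2 / b) *\<^sub>R v)"
  have f: "orthogonal_transformation f"
    unfolding f_def by (rule orthogonal_frame) (use * in auto)
  have "f ` corners a b = {0, u, u + v, v}"
    using * by (simp add: corners_def f_def)
  then have "(+) A ` f ` corners a b = {A, A + u, A + u + v, A + v}"
    by (simp add: add.assoc)
  then have "R = (+) A ` f ` (convex hull (corners a b))"
    using f R
    by (metis convex_hull_linear_image convex_hull_translation orthogonal_transformation_linear)
  with f show ?thesis
    unfolding isometric_image_def by blast
qed

lemma convex_hull_corners:
  assumes "a > 0" "b > 0"
  shows "convex hull (corners a b) = cbox (vec2 0 0) (vec2 a b)"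
proof
  show "convex hull (corners a b) \<subseteq> cbox (vec2 0 0) (vec2 a b)"
    using assms
    by (intro hull_minimal convex_box) (auto simp: corners_def mem_box_cart forall_2)
  show "cbox (vec2 0 0) (vec2 a b) \<subseteq> convex hull (corners a b)"
  proof
    fix x assume "x \<in> cbox (vec2 0 0) (vec2 a b)"
    then have x: "0 \<le> x$1" "x$1 \<le> a" "0 \<le> x$2" "x$2 \<le> b"
      by (auto simp: mem_box_cart forall_2)
    have seg: "closed_segment y z \<subseteq> convex hull (corners a b)"
      if "y \<in> convex hull (corners a b)" "z \<in> convex hull (corners a b)" for y z
      using that by (simp add: closed_segment_subset)
    have corner: "z \<in> convex hull (corners a b)" if "z \<in> corners a b" for z
      using that by (rule hull_inc)
    \<comment> \<open>A point of the box lies on the vertical segment through it, whose two ends lie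
      on the bottom and top sides.\<close>
    have "vec2 (x$1) y \<in> closed_segment (vec2 0 y) (vec2 a y)" for y
      unfolding closed_segment_def mem_Collect_eq
      by (rule exI[of _ "x$1 / a"])
         (use x assms in \<open>auto simp: vec_eq_iff forall_2 field_simps\<close>)
    then have side: "vec2 (x$1) y \<in> convex hull (corners a b)"
      if "vec2 0 y \<in> corners a b" "vec2 a y \<in> corners a b" for y
      using seg corner that by blast
    have "vec2 (x$1) 0 \<in> convex hull (corners a b)" "vec2 (x$1) b \<in> convex hull (corners a b)"
      by (rule side; simp add: corners_def)+
    moreover have "x \<in> closed_segment (vec2 (x$1) 0) (vec2 (x$1) b)"
      unfolding closed_segment_def mem_Collect_eq
      by (rule exI[of _ "x$2 / b"])
         (use x assms in \<open>auto simp: vec_eq_iff forall_2 field_simps\<close>)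
    ultimately show "x \<in> convex hull (corners a b)"
      using seg by blast
  qed
qed

section \<open>Invariance under isometries\<close>

lemma area_isometric_image:
  assumes "isometric_image S R" "compact S"
  shows "area R = area S"
  using assms unfolding isometric_image_def area_def
  by (auto simp: measure_translation measure_orthogonal_image lmeasurable_compact)

lemma diameter_isometry:
  assumes "\<And>x y. dist (f x) (f y) = dist x y"
  shows "diameter (f ` S) = diameter S"
proof (cases "S = {}")
  case False
  have "(\<lambda>(x, y). dist x y) ` (f ` S \<times> f ` S) = (\<lambda>(x, y). dist x y) ` (S \<times> S)"
    using assms by (force simp: image_iff)
  with False show ?thesis
    by (simp add: diameter_def)
qed simp

text \<open>An injective affine map induces a bijection between the edges of \<open>S\<close> and of
  its image, and an isometry keeps their diameters.\<close>

lemma perimeter_isometric_image: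
  assumes "isometric_image S R"
  shows "perimeter R = perimeter S"
proof -
  from assms obtain t f where f: "orthogonal_transformation f" and R: "R = (+) t ` f ` S"
    unfolding isometric_image_def by blast
  define h where "h x = t + f x" for x
  have lin: "linear f" "inj f"
    using f by (auto simp: orthogonal_transformation_linear orthogonal_transformation_inj)
  have img: "h ` X = (+) t ` f ` X" for X
    by (auto simp: h_def)
  have dist: "dist (h x) (h y) = dist x y" for x y
    using f by (simp add: h_def orthogonal_transformation_isometry)
  have "inj h"
    using dist by (metis dist_eq_0_iff injI)
  have edge: "h ` e edge_of R \<longleftrightarrow> e edge_of S" for e
    unfolding edge_of_def R img
    using lin by (simp add: face_of_linear_image aff_dim_translation_eq)
  have "{e. e edge_of R} = (`) h ` {e. e edge_of S}"
  proof (intro equalityI subsetI)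
    fix e assume "e \<in> {e. e edge_of R}"
    then have e: "e edge_of R" by simp
    then have "e \<subseteq> h ` S"
      unfolding img by (metis R edge_of_imp_subset)
    then obtain e' where "e = h ` e'"
      by (meson subset_imageE)
    with e edge show "e \<in> (`) h ` {e. e edge_of S}"
      by blast
  qed (use edge in auto)
  moreover have "inj_on ((`) h) {e. e edge_of S}"
    using \<open>inj h\<close> by (simp add: inj_on_def inj_image_eq_iff)
  ultimately show ?thesis
    unfolding perimeter_def by (simp add: sum.reindex diameter_isometry[of h] dist)
qed

text \<open>A distance-preserving self-map of Euclidean space that fixes the origin is orthogonal;
  subtracting \<open>f 0\<close> reduces to this case.\<close>

lemma congruent_figures_imp_isometric_image:
  assumes "congruent_figures P Q"
  shows "isometric_image P Q"
proof -
  from assms obtain f where f: "\<And>x y. dist (f x) (f y) = dist x y" and Q: "f ` P = Q"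
    unfolding congruent_figures_def by blast
  define g where "g x = f x - f 0" for x
  have "orthogonal_transformation g"
    unfolding orthogonal_transformation_isometry g_def
    using f by (simp add: dist_norm)
  moreover have "Q = (+) (f 0) ` g ` P"
    using Q by (auto simp: g_def image_image)
  ultimately show ?thesis
    unfolding isometric_image_def by blast
qed

text \<open>Undo the isometry onto \<open>P\<close>, then apply the one onto \<open>Q\<close>. With
  the normal form this makes rectangles with equal sides congruent.\<close>

lemma isometric_images_congruent:
  assumes "isometric_image S P" "isometric_image S Q"
  shows "congruent_figures P Q"
proof -
  from assms obtain s f t g where
    f: "orthogonal_transformation f" "P = (+) s ` f ` S" and
    g: "orthogonal_transformation g" "Q = (+) t ` g ` S"
    unfolding isometric_image_def by blast
  define h where "h x = t + g (inv f (x - s))" for x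
  have inv: "orthogonal_transformation (inv f)"
    using f(1) by (rule orthogonal_transformation_inv)
  have "dist (h x) (h y) = dist x y" for x y
    using inv g(1) by (simp add: h_def orthogonal_transformation_isometry) (simp add: dist_norm)
  moreover have "inv f (f x) = x" for x
    using f(1) by (simp add: orthogonal_transformation_inj)
  then have "h ` P = Q"
    by (simp add: f(2) g(2) h_def image_image)
  ultimately show ?thesis
    unfolding congruent_figures_def by blast
qed

section \<open>Area, perimeter and vertices of a rectangle\<close>

lemma area_rectangle:
  assumes "rectangle_by a b R"
  shows "area R = a * b"
proof -
  have ab: "a > 0" "b > 0"
    using assms by (rule rectangle_by_pos)+
  then have "cbox (vec2 0 0) (vec2 a b) \<noteq> {}"
    by (auto simp: interval_ne_empty_cart forall_2)
  then have "area (cbox (vec2 0 0) (vec2 a b)) = a * b"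
    by (simp add: area_def content_cbox_cart UNIV_2)
  with area_isometric_image[OF rectangle_by_isometric_corners[OF assms]] ab show ?thesis
    by (simp add: convex_hull_corners compact_cbox)
qed

lemma diameter_closed_segment:
  fixes x y :: "'a::euclidean_space"
  shows "diameter (closed_segment x y) = dist x y"
proof (rule antisym)
  show "diameter (closed_segment x y) \<le> dist x y"
  proof (rule diameter_le)
    fix p q assume p: "p \<in> closed_segment x y" and q: "q \<in> closed_segment x y"
    have "closed_segment x y \<subseteq> cball p (dist x y)"
      by (rule closed_segment_subset) (use dist_in_closed_segment[OF p] in auto)
    with q show "norm (p - q) \<le> dist x y"
      by (auto simp: dist_norm)
  qed auto
  show "dist x y \<le> diameter (closed_segment x y)"
    by (intro diameter_bounded_bound bounded_closed_segment) auto
qed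

text \<open>A face is thus determined by the generators it contains, which reduces finding edges and
  vertices to finite combinatorics.\<close>

lemma face_of_convex_hull_eq_hull_Int:
  fixes V :: "'a::euclidean_space set"
  assumes "compact V" "F face_of convex hull V"
  shows "F = convex hull (F \<inter> V)"
proof
  obtain V' where V': "V' \<subseteq> V" "F = convex hull V'"
    using face_of_convex_hull_subset[OF assms] .
  then show "F \<subseteq> convex hull (F \<inter> V)"
    by (simp add: hull_mono hull_subset)
  show "convex hull (F \<inter> V) \<subseteq> F"
    by (rule hull_minimal) (use assms in \<open>auto dest: face_of_imp_convex\<close>)
qed

text \<open>With the four points in cyclic order, the two excluded pairs are the diagonals; what is
  left are the sides.\<close>

lemma adjacent_pair:
  assumes "E \<subseteq> {o', p, q, r}" "\<not> (o' \<in> E \<and> q \<in> E)" "\<not> (p \<in> E \<and> r \<in> E)"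
    and "E \<noteq> {}" "\<And>x. E \<noteq> {x}"
  shows "E \<in> {{o', p}, {p, q}, {r, q}, {o', r}}"
proof -
  obtain x y where "x \<in> E" "y \<in> E" "x \<noteq> y"
    using assms(4,5) by blast
  then have "E = {x, y}"
    using assms(1-3) by blast
  moreover have "x \<in> {o', p, q, r}" "y \<in> {o', p, q, r}"
    using \<open>x \<in> E\<close> \<open>y \<in> E\<close> assms(1) by blast+
  ultimately show ?thesis
    using assms(2,3) \<open>x \<noteq> y\<close> by auto
qed

text \<open>The diagonals share their midpoint, so a face containing one contains the other, hence
  all corners, and is then two-dimensional. An edge therefore meets the corners in two adjacent
  ones. Conversely, each side is cut out by a supporting line.\<close>

lemma edges_convex_hull_corners:
  assumes "a > 0" "b > 0"
  shows "{e. e edge_of convex hull (corners a b)} =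
    {closed_segment (vec2 0 0) (vec2 a 0), closed_segment (vec2 a 0) (vec2 a b),
     closed_segment (vec2 0 b) (vec2 a b), closed_segment (vec2 0 0) (vec2 0 b)}"
    (is "?L = ?R")
proof
  let ?S = "convex hull (corners a b)"
  have compact: "compact (corners a b)"
    by (simp add: corners_def finite_imp_compact)
  have box: "?S = cbox (vec2 0 0) (vec2 a b)"
    by (rule convex_hull_corners) fact+
  show "?L \<subseteq> ?R"
  proof
    fix e assume "e \<in> ?L"
    then have face: "e face_of ?S" and dim: "aff_dim e = 1"
      by (auto simp: edge_of_def)
    have e: "e = convex hull (e \<inter> corners a b)"
      by (rule face_of_convex_hull_eq_hull_Int) fact+
    \<comment> \<open>The common midpoint lies in \<open>e\<close> by convexity and is a relative
      interior point of the segment from \<open>z\<close> to \<open>w\<close>, so the face property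
      puts both ends into \<open>e\<close>.\<close>
    have mid: "z \<in> e \<and> w \<in> e"
      if "midpoint x y = midpoint z w" "x \<in> e" "y \<in> e" "z \<in> ?S" "w \<in> ?S" "z \<noteq> w" for x y z w
    proof -
      have "midpoint x y \<in> e"
        using closed_segment_subset[OF that(2,3) face_of_imp_convex[OF face]] by auto
      then have "midpoint z w \<in> e"
        using that(1) by simp
      moreover have "midpoint z w \<in> open_segment z w"
        using that(6) by simp
      ultimately show ?thesis
        using face that(4,5) unfolding face_of_def by blast
    qed
    have not_all: "\<not> corners a b \<subseteq> e"
    proof
      assume "corners a b \<subseteq> e"
      then have "e = ?S"
        using e by (metis Int_absorb1)
      moreover have "interior ?S \<noteq> {}"
        using assms by (simp add: box interior_cbox interval_ne_empty_cart forall_2)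
      ultimately show False
        using dim by (simp add: aff_dim_nonempty_interior)
    qed
    have vertices: "vec2 0 0 \<in> ?S" "vec2 a 0 \<in> ?S" "vec2 a b \<in> ?S" "vec2 0 b \<in> ?S"
      using assms by (simp_all add: box mem_box_cart forall_2)
    have center: "midpoint (vec2 0 0) (vec2 a b) = midpoint (vec2 a 0) (vec2 0 b)"
      by (simp add: midpoint_def vec_eq_iff forall_2)
    have "\<not> (vec2 0 0 \<in> e \<and> vec2 a b \<in> e)"
    proof
      assume *: "vec2 0 0 \<in> e \<and> vec2 a b \<in> e"
      then have "vec2 a 0 \<in> e \<and> vec2 0 b \<in> e"
        by (intro mid[OF center]) (use assms vertices in auto)
      with * not_all show False
        by (simp add: corners_def)
    qed
    moreover have "\<not> (vec2 a 0 \<in> e \<and> vec2 0 b \<in> e)"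
    proof
      assume *: "vec2 a 0 \<in> e \<and> vec2 0 b \<in> e"
      then have "vec2 0 0 \<in> e \<and> vec2 a b \<in> e"
        by (intro mid[OF center[symmetric]]) (use assms vertices in auto)
      with * not_all show False
        by (simp add: corners_def)
    qed
    moreover have "e \<inter> corners a b \<noteq> {}"
    proof
      assume "e \<inter> corners a b = {}"
      with e have "e = {}"
        by (metis convex_hull_empty)
      with dim show False
        by simp
    qed
    moreover have "e \<inter> corners a b \<noteq> {x}" for x
    proof
      assume "e \<inter> corners a b = {x}"
      with e have "e = {x}"
        by (metis convex_hull_singleton)
      with dim show False
        by simp
    qed
    ultimately have "e \<inter> corners a b \<in> {{vec2 0 0, vec2 a 0}, {vec2 a 0, vec2 a b},
        {vec2 0 b, vec2 a b}, {vec2 0 0, vec2 0 b}}"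
      by (intro adjacent_pair) (auto simp: corners_def)
    then have "convex hull (e \<inter> corners a b) \<in> ?R"
      unfolding segment_convex_hull by (elim insertE emptyE) simp_all
    with e show "e \<in> ?R"
      by (rule ssubst)
  qed
  \<comment> \<open>\<open>n\<close> is the normal of the supporting line; which corners lie on the
    line already determines the face.\<close>
  have edge: "closed_segment y z edge_of ?S"
    if "(\<forall>x\<in>?S. n \<bullet> x \<le> k) \<or> (\<forall>x\<in>?S. n \<bullet> x \<ge> k)"
      "\<And>x. x \<in> corners a b \<Longrightarrow> n \<bullet> x = k \<longleftrightarrow> x = y \<or> x = z"
      "y \<in> corners a b" "z \<in> corners a b" "y \<noteq> z" for n k y z
  proof -
    let ?F = "?S \<inter> {x. n \<bullet> x = k}"
    have face: "?F face_of ?S"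
      using that(1)
      by (auto intro: face_of_Int_supporting_hyperplane_le face_of_Int_supporting_hyperplane_ge)
    have "?F \<inter> corners a b = {y, z}"
      using hull_subset[of "corners a b" convex] that(2-4) by blast
    then have eq: "?F = closed_segment y z"
      using face_of_convex_hull_eq_hull_Int[OF compact face] by (metis segment_convex_hull)
    have "aff_dim (closed_segment y z) = 1"
      using \<open>y \<noteq> z\<close> by (simp add: segment_convex_hull aff_dim_convex_hull aff_dim_2)
    with face eq show ?thesis
      by (simp add: edge_of_def)
  qed
  have coord: "axis 1 1 \<bullet> x = x$1" "axis 2 1 \<bullet> x = x$2" for x :: "real^2"
    by (simp_all add: inner_axis')
  have bounds: "\<forall>x\<in>?S. 0 \<le> x$1" "\<forall>x\<in>?S. x$1 \<le> a" "\<forall>x\<in>?S. 0 \<le> x$2" "\<forall>x\<in>?S. x$2 \<le> b"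
    by (auto simp: box mem_box_cart forall_2)
  have "closed_segment (vec2 0 0) (vec2 a 0) edge_of ?S"
    by (rule edge[of "axis 2 1" 0]) (use bounds assms in \<open>auto simp: coord corners_def\<close>)
  moreover have "closed_segment (vec2 a 0) (vec2 a b) edge_of ?S"
    by (rule edge[of "axis 1 1" a]) (use bounds assms in \<open>auto simp: coord corners_def\<close>)
  moreover have "closed_segment (vec2 0 b) (vec2 a b) edge_of ?S"
    by (rule edge[of "axis 2 1" b]) (use bounds assms in \<open>auto simp: coord corners_def\<close>)
  moreover have "closed_segment (vec2 0 0) (vec2 0 b) edge_of ?S"
    by (rule edge[of "axis 1 1" 0]) (use bounds assms in \<open>auto simp: coord corners_def\<close>)
  ultimately show "?R \<subseteq> ?L"
    by simp
qed

lemma perimeter_rectangle: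
  assumes "rectangle_by a b R"
  shows "perimeter R = 2 * (a + b)"
proof -
  have ab: "a > 0" "b > 0"
    using assms by (rule rectangle_by_pos)+
  have "perimeter (convex hull (corners a b)) = 2 * (a + b)"
    \<comment> \<open>The sum runs over a set, so the four sides must be seen to be distinct; this
      is decided by comparing their endpoint pairs.\<close>
    using ab unfolding perimeter_def edges_convex_hull_corners[OF ab]
    by (simp add: doubleton_eq_iff diameter_closed_segment dist_vec_def L2_set_def sum_2 dist_real_def)
  with perimeter_isometric_image[OF rectangle_by_isometric_corners[OF assms]] show ?thesis
    by simp
qed

text \<open>The functional given by \<open>u + v\<close> is minimal at \<open>A\<close>: at the
  other generators it is larger by the squared norm of \<open>u\<close>, of \<open>v\<close>, or by
  their sum.\<close>

lemma extreme_point_of_corner: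
  fixes A u v :: "'a::euclidean_space"
  assumes "u \<bullet> v = 0"
  shows "A extreme_point_of convex hull {A, A + u, A + u + v, A + v}"
proof -
  let ?V = "{A, A + u, A + u + v, A + v}" and ?n = "u + v"
  let ?F = "convex hull ?V \<inter> {x. ?n \<bullet> x = ?n \<bullet> A}"
  have "?V \<subseteq> {x. ?n \<bullet> x \<ge> ?n \<bullet> A}"
    using assms by (auto simp: inner_add_left inner_add_right inner_commute)
  then have "convex hull ?V \<subseteq> {x. ?n \<bullet> x \<ge> ?n \<bullet> A}"
    by (simp add: hull_minimal convex_halfspace_ge)
  then have F: "?F face_of convex hull ?V"
    by (intro face_of_Int_supporting_hyperplane_ge) auto
  have pos: "u \<bullet> u + v \<bullet> v = 0 \<longleftrightarrow> u = 0 \<and> v = 0"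
    by (simp add: add_nonneg_eq_0_iff)
  have "A \<in> convex hull ?V"
    by (simp add: hull_inc)
  then have "?F \<inter> ?V = {A}"
    using assms pos by (auto simp: inner_add_left inner_add_right inner_commute)
  moreover have "compact ?V"
    by (simp add: finite_imp_compact)
  ultimately have "?F = {A}"
    using face_of_convex_hull_eq_hull_Int[OF _ F] by (metis convex_hull_singleton)
  with F show ?thesis
    by (simp add: face_of_singleton)
qed

section \<open>The sides of a lattice rectangle with rational perimeter\<close>

text \<open>In lowest terms p/q, the denominator divides p * p but is coprime to it.\<close>

lemma Rats_square_Ints_imp_Ints:
  fixes x :: real
  assumes "x \<in> \<rat>" "x\<^sup>2 \<in> \<int>"
  shows "x \<in> \<int>"
proof -
  obtain p q :: int where pq: "q > 0" "coprime p q" "x = of_int p / of_int q"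
    using assms(1) by (auto elim: Rats_cases')
  obtain k :: int where "x\<^sup>2 = of_int k"
    using assms(2) by (auto elim: Ints_cases)
  then have "real_of_int (p\<^sup>2) = of_int (k * q\<^sup>2)"
    using pq by (simp add: field_simps power2_eq_square)
  then have "p\<^sup>2 = k * q\<^sup>2"
    by (simp only: of_int_eq_iff)
  then have "q dvd p\<^sup>2"
    by (simp add: power2_eq_square)
  moreover have "coprime q (p\<^sup>2)"
    using pq(2) by (simp add: coprime_commute)
  ultimately have "is_unit q"
    by (metis coprime_absorb_left)
  then have "q = 1"
    using pq(1) by simp
  with pq show ?thesis
    by simp
qed

lemma lattice_rectangle_by_cases:
  assumes "lattice_rectangle R" "rectangle_by a b R"
  obtains u v :: "real^2" where "u \<bullet> v = 0" "norm u = a" "norm v = b"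
    "\<forall>i. u$i \<in> \<int>" "\<forall>i. v$i \<in> \<int>"
proof -
  from assms(2) obtain A u v where *: "u \<bullet> v = 0" "norm u = a" "norm v = b" "a > 0" "b > 0"
    and R: "R = convex hull {A, A + u, A + u + v, A + v}"
    by (rule rectangle_by_cases)
  have int: "x extreme_point_of R \<Longrightarrow> x$i \<in> \<int>" for x i
    using assms(1) unfolding lattice_rectangle_def by blast
  \<comment> \<open>The same vertex set based at \<open>A + u\<close> and at \<open>A + v\<close>,
    so that \<open>extreme_point_of_corner\<close> applies there too.\<close>
  have eqs: "{A + u, A + u + - u, A + u + - u + v, A + u + v} = {A, A + u, A + u + v, A + v}"
    "{A + v, A + v + u, A + v + u + - v, A + v + - v} = {A, A + u, A + u + v, A + v}"
    by (auto simp: ac_simps)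
  have "A extreme_point_of R"
    unfolding R by (rule extreme_point_of_corner) fact
  moreover have "A + u extreme_point_of R"
    using extreme_point_of_corner[of "-u" v "A + u"] *(1) by (simp only: R eqs) simp
  moreover have "A + v extreme_point_of R"
    using extreme_point_of_corner[of u "-v" "A + v"] *(1) by (simp only: R eqs) simp
  ultimately have "(A + u)$i - A$i \<in> \<int>" "(A + v)$i - A$i \<in> \<int>" for i
    by (simp_all only: int Ints_diff)
  then have "\<forall>i. u$i \<in> \<int>" "\<forall>i. v$i \<in> \<int>"
    by simp_all
  with *(1-3) show thesis
    by (rule that)
qed

text \<open>By Lagrange's identity, the product of the squared norms is the squared determinant plus
  the squared inner product, and the latter vanishes.\<close>

lemma lattice_rectangle_area_Ints:
  assumes "lattice_rectangle R" "rectangle_by a b R"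
  shows "a * b \<in> \<int>"
proof -
  obtain u v :: "real^2" where *: "u \<bullet> v = 0" "norm u = a" "norm v = b"
    and int: "\<forall>i. u$i \<in> \<int>" "\<forall>i. v$i \<in> \<int>"
    by (rule lattice_rectangle_by_cases[OF assms])
  have dot: "u$1 * v$1 + u$2 * v$2 = 0"
    using *(1) by (simp add: inner_vec_def sum_2)
  have "a\<^sup>2 = (u$1)\<^sup>2 + (u$2)\<^sup>2" "b\<^sup>2 = (v$1)\<^sup>2 + (v$2)\<^sup>2"
    unfolding *(2,3)[symmetric]
    by (simp_all add: power2_norm_eq_inner inner_vec_def sum_2) (simp_all add: power2_eq_square)
  then have "(a * b)\<^sup>2 = ((u$1)\<^sup>2 + (u$2)\<^sup>2) * ((v$1)\<^sup>2 + (v$2)\<^sup>2)"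
    by (simp add: power_mult_distrib)
  also have "\<dots> = (u$1 * v$2 - u$2 * v$1)\<^sup>2 + (u$1 * v$1 + u$2 * v$2)\<^sup>2"
    by (simp add: power2_eq_square algebra_simps)
  finally have "(a * b)\<^sup>2 = (u$1 * v$2 - u$2 * v$1)\<^sup>2"
    using dot by simp
  then have "a * b = u$1 * v$2 - u$2 * v$1 \<or> a * b = - (u$1 * v$2 - u$2 * v$1)"
    by (simp add: power2_eq_iff)
  moreover have "u$1 * v$2 - u$2 * v$1 \<in> \<int>"
    using int by simp
  ultimately show ?thesis
    by (metis Ints_minus)
qed

text \<open>Both a * a and b * b are integers, so once a + b is rational, so is
  a - b = (a * a - b * b) / (a + b).\<close>

lemma lattice_rectangle_sides_Ints:
  assumes "lattice_rectangle R" "rectangle_by a b R" "a + b \<in> \<rat>"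
  shows "a \<in> \<int> \<and> b \<in> \<int>"
proof -
  have ab: "a > 0" "b > 0"
    using assms(2) by (rule rectangle_by_pos)+
  obtain u v :: "real^2" where *: "u \<bullet> v = 0" "norm u = a" "norm v = b"
    and int: "\<forall>i. u$i \<in> \<int>" "\<forall>i. v$i \<in> \<int>"
    by (rule lattice_rectangle_by_cases[OF assms(1,2)])
  have "a\<^sup>2 = u$1 * u$1 + u$2 * u$2" "b\<^sup>2 = v$1 * v$1 + v$2 * v$2"
    using * by (auto simp: power2_norm_eq_inner inner_vec_def sum_2)
  then have sq: "a\<^sup>2 \<in> \<int>" "b\<^sup>2 \<in> \<int>"
    using int by simp_all
  have "(a - b) * (a + b) = a\<^sup>2 - b\<^sup>2"
    by (simp add: algebra_simps power2_eq_square)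
  then have "a - b = (a\<^sup>2 - b\<^sup>2) / (a + b)"
    using ab by (simp add: eq_divide_eq)
  moreover have "a\<^sup>2 \<in> \<rat>" "b\<^sup>2 \<in> \<rat>"
    using sq Ints_subset_Rats by blast+
  ultimately have "a - b \<in> \<rat>"
    using assms(3) by (simp only: Rats_divide Rats_diff)
  then have "((a + b) + (a - b)) / 2 \<in> \<rat>" "((a + b) - (a - b)) / 2 \<in> \<rat>"
    using assms(3) by (simp_all only: Rats_divide Rats_add Rats_diff Rats_number_of)
  moreover have "((a + b) + (a - b)) / 2 = a" "((a + b) - (a - b)) / 2 = b"
    by simp_all
  ultimately have "a \<in> \<rat>" "b \<in> \<rat>"
    by metis+
  with sq show ?thesis
    using Rats_square_Ints_imp_Ints by blast
qed

text \<open>Shows that the listed rectangles exist, so that the claim about all of them is not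
  vacuous.\<close>

lemma axis_parallel_lattice_rectangle:
  fixes a b :: real
  assumes "a \<in> \<int>" "b \<in> \<int>" "a > 0" "b > 0"
  shows "\<exists>R. lattice_rectangle R \<and> rectangle_by a b R"
proof (intro exI conjI)
  let ?R = "convex hull {0, 0 + vec2 a 0, 0 + vec2 a 0 + vec2 0 b, 0 + vec2 0 b}"
  have norm: "norm (vec2 a 0) = a" "norm (vec2 0 b) = b"
    using assms by (simp_all add: norm_vec_def L2_set_def sum_2)
  show R: "rectangle_by a b ?R"
    using rectangle_by_intro[of "vec2 a 0" "vec2 0 b" 0] assms
    by (simp add: norm inner_vec_def sum_2)
  have "x$i \<in> \<int>" if "x extreme_point_of ?R" for x i
    using extreme_point_of_convex_hull[OF that] assms exhaust_2[of i] by auto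
  with R show "lattice_rectangle ?R"
    unfolding lattice_rectangle_def rectangle_def by blast
qed

section \<open>The Diophantine system\<close>

text \<open>Adding the two equations gives (a - 2)(b - 2) + (c - 2)(d - 2) = 8, which bounds everything
  if a \<open>\<ge>\<close> 3. For a = 2 what remains is (c - 2)(d - 2) = 8; for a = 1 substituting
  b = 2(c + d) gives (c - 4)(d - 4) = 18.\<close>

lemma amicable_sides_ordered:
  fixes a b c d :: int
  assumes "a * b = 2 * (c + d)" "c * d = 2 * (a + b)"
    and "0 < a" "a \<le> b" "a \<le> c" "c \<le> d"
  shows "(a, b, c, d) \<in> {(1, 34, 7, 10), (1, 38, 6, 13), (1, 54, 5, 22), (2, 10, 4, 6), (2, 13, 3, 10)}
    \<or> a = c \<and> b = d"
proof -
  have sum: "(a - 2) * (b - 2) + (c - 2) * (d - 2) = 8"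
    using assms(1,2) by (simp add: algebra_simps)
  consider "a = 1" | "a = 2" | "a \<ge> 3"
    using assms(3) by linarith
  then show ?thesis
  proof cases
    case 1
    then have b: "b = 2 * (c + d)" and cd: "(c - 4) * (d - 4) = 18"
      using assms(1,2) by (simp_all add: algebra_simps)
    \<comment> \<open>c = 4 makes the product 0, and c < 4 would make d negative.\<close>
    have "c \<ge> 5"
    proof (rule ccontr)
      assume "\<not> c \<ge> 5"
      then have "c = 1 \<or> c = 2 \<or> c = 3 \<or> c = 4"
        using 1 assms(5) by linarith
      then show False
        using cd assms(5,6) 1 by auto
    qed
    then have "(c - 4) * (c - 4) \<le> 18"
      using mult_left_mono[of "c - 4" "d - 4" "c - 4"] assms(6) cd by simp
    then have "c - 4 < 5"
      by (intro power2_less_imp_less[of _ 5]) (simp_all add: power2_eq_square)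
    then have "c = 5 \<or> c = 6 \<or> c = 7 \<or> c = 8"
      using \<open>c \<ge> 5\<close> by linarith
    \<comment> \<open>c = 8 would need 4(d - 4) = 18; the other values give d = 22, 13, 10.\<close>
    then show ?thesis
      using 1 b cd by (elim disjE) (auto, presburger)
  next
    case 2
    then have b: "b = c + d" and cd: "(c - 2) * (d - 2) = 8"
      using assms(1) sum by simp_all
    have "c \<noteq> 2" using cd by auto
    then have "c \<ge> 3" using 2 assms(5) by linarith
    then have "(c - 2) * (c - 2) \<le> 8"
      using mult_left_mono[of "c - 2" "d - 2" "c - 2"] assms(6) cd by simp
    then have "c - 2 < 3"
      by (intro power2_less_imp_less[of _ 3]) (simp_all add: power2_eq_square)
    then have "c = 3 \<or> c = 4"
      using \<open>c \<ge> 3\<close> by linarith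
    then show ?thesis
      using 2 b cd by auto
  next
    case 3
    have "1 * 1 \<le> (a - 2) * (b - 2)" "(c - 2) * (c - 2) \<le> (c - 2) * (d - 2)"
      using 3 assms(4-6) by (intro mult_mono; simp)+
    then have "(c - 2) * (c - 2) < 3 * 3"
      using sum by simp
    then have "c - 2 < 3"
      by (intro power2_less_imp_less[of _ 3]) (simp_all add: power2_eq_square)
    then have "a = 3 \<and> c = 3 \<or> a = 3 \<and> c = 4 \<or> a = 4 \<and> c = 4"
      using 3 assms(5) by linarith
    \<comment> \<open>Once a and c are fixed the equations are linear: a = c = 3 gives b = d = 6, a
      = c = 4 gives b = d = 4, and a = 3, c = 4 would need 4d = 17.\<close>
    then have "b = d \<and> a = c"
      using assms(1,2) by (elim disjE conjE; simp; presburger)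
    then show ?thesis
      by simp
  qed
qed

section \<open>From amicable rectangles to integer solutions and back\<close>

lemma amicable_sides:
  fixes R1 R2 :: "(real^2) set"
  assumes "lattice_rectangle R1" "lattice_rectangle R2" "amicable R1 R2"
  obtains a b c d :: int where "rectangle_by a b R1" "rectangle_by c d R2"
    "0 < a" "a \<le> b" "0 < c" "c \<le> d" "a * b = 2 * (c + d)" "c * d = 2 * (a + b)"
    "\<not> (a = c \<and> b = d)"
proof -
  have sides: "\<exists>a b :: real. rectangle_by a b R \<and> a \<le> b" if "lattice_rectangle R" for R
    using that unfolding lattice_rectangle_def rectangle_def
    by (metis linear rectangle_by_commute)
  from sides assms obtain a b c d :: real where
    R1: "rectangle_by a b R1" and ab: "a \<le> b" and R2: "rectangle_by c d R2" and cd: "c \<le> d"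
    by metis
  have pos: "a > 0" "c > 0"
    using R1 R2 by (blast intro: rectangle_by_pos)+
  have eqs: "a * b = 2 * (c + d)" "c * d = 2 * (a + b)"
    using assms(3) R1 R2 unfolding amicable_def by (simp_all add: area_rectangle perimeter_rectangle)
  \<comment> \<open>The integral area of each rectangle is the perimeter of the other, which makes
    both side sums rational.\<close>
  have "a * b \<in> \<int>" "c * d \<in> \<int>"
    using lattice_rectangle_area_Ints assms R1 R2 by blast+
  then have "a * b \<in> \<rat>" "c * d \<in> \<rat>"
    using Ints_subset_Rats by blast+
  then have "a * b / 2 \<in> \<rat>" "c * d / 2 \<in> \<rat>"
    by (simp_all only: Rats_divide Rats_number_of)
  moreover have "c * d / 2 = a + b" "a * b / 2 = c + d"
    unfolding eqs by simp_all
  ultimately have "a + b \<in> \<rat>" "c + d \<in> \<rat>"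
    by (simp_all only:)
  then have "a \<in> \<int>" "b \<in> \<int>" "c \<in> \<int>" "d \<in> \<int>"
    using lattice_rectangle_sides_Ints assms R1 R2 by blast+
  then obtain a' b' c' d' :: int where int: "a = a'" "b = b'" "c = c'" "d = d'"
    by (metis Ints_cases)
  show thesis
  proof (rule that[of a' b' c' d'])
    have "real_of_int (a' * b') = of_int (2 * (c' + d'))" "real_of_int (c' * d') = of_int (2 * (a' + b'))"
      using eqs by (simp_all add: int)
    then show "a' * b' = 2 * (c' + d')" "c' * d' = 2 * (a' + b')"
      by (simp_all only: of_int_eq_iff)
    \<comment> \<open>Equal sides would make both rectangles isometric images of the same
      box.\<close>
    show "\<not> (a' = c' \<and> b' = d')"
      using R1 R2 assms(3) isometric_images_congruent rectangle_by_isometric_corners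
      unfolding amicable_def int by blast
  qed (use R1 R2 ab cd pos in \<open>simp_all add: int\<close>)
qed

theorem theorem4:
  shows "(\<forall>((a, b), (c, d)) \<in> listed_pairs.
            (\<exists>R. lattice_rectangle R \<and> rectangle_by a b R) \<and>
            (\<exists>R. lattice_rectangle R \<and> rectangle_by c d R) \<and>
            (\<forall>R1 R2. lattice_rectangle R1 \<and> rectangle_by a b R1 \<and>
                     lattice_rectangle R2 \<and> rectangle_by c d R2 \<longrightarrow> amicable R1 R2))
       \<and> (\<forall>R1 R2. lattice_rectangle R1 \<and> lattice_rectangle R2 \<and> amicable R1 R2 \<longrightarrow>
            (\<exists>((a, b), (c, d)) \<in> listed_pairs.
               rectangle_by a b R1 \<and> rectangle_by c d R2 \<or>
               rectangle_by a b R2 \<and> rectangle_by c d R1))"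
proof (intro conjI allI impI)
  \<comment> \<open>Unequal areas rule out congruence, since congruent figures have equal
    area.\<close>
  have amicable: "amicable R1 R2"
    if "rectangle_by a b R1" "rectangle_by c d R2"
      "a * b = 2 * (c + d)" "c * d = 2 * (a + b)" "a * b \<noteq> c * d" for a b c d R1 R2
  proof -
    have "area R2 \<noteq> area R1"
      using that by (simp add: area_rectangle)
    moreover have "compact R1"
      using that(1) unfolding rectangle_by_def
      by (auto intro!: finite_imp_compact_convex_hull)
    ultimately have "\<not> congruent_figures R1 R2"
      using area_isometric_image congruent_figures_imp_isometric_image by blast
    with that show ?thesis
      by (simp add: amicable_def area_rectangle perimeter_rectangle)
  qed
  show "\<forall>((a, b), (c, d)) \<in> listed_pairs.
            (\<exists>R. lattice_rectangle R \<and> rectangle_by a b R) \<and>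
            (\<exists>R. lattice_rectangle R \<and> rectangle_by c d R) \<and>
            (\<forall>R1 R2. lattice_rectangle R1 \<and> rectangle_by a b R1 \<and>
                     lattice_rectangle R2 \<and> rectangle_by c d R2 \<longrightarrow> amicable R1 R2)"
    unfolding listed_pairs_def
    by (auto intro!: axis_parallel_lattice_rectangle intro: amicable)
next
  fix R1 R2 assume "lattice_rectangle R1 \<and> lattice_rectangle R2 \<and> amicable R1 R2"
  then obtain a b c d :: int where R: "rectangle_by a b R1" "rectangle_by c d R2"
    and *: "0 < a" "a \<le> b" "0 < c" "c \<le> d" "a * b = 2 * (c + d)" "c * d = 2 * (a + b)"
    "\<not> (a = c \<and> b = d)"
    using amicable_sides by metis
  let ?list = "{(1, 34, 7, 10), (1, 38, 6, 13), (1, 54, 5, 22), (2, 10, 4, 6), (2, 13, 3, 10)}"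
  have listed: "((of_int a, of_int b), (of_int c, of_int d)) \<in> listed_pairs"
    if "(a, b, c, d) \<in> ?list" for a b c d :: int
    using that unfolding listed_pairs_def by (elim insertE emptyE) simp_all
  \<comment> \<open>The classification wants the smallest of the four sides first, which is where
    the exchange of the two rectangles comes from.\<close>
  have "(a, b, c, d) \<in> ?list \<or> (c, d, a, b) \<in> ?list"
  proof (cases "a \<le> c")
    case True
    then show ?thesis
      using amicable_sides_ordered[OF *(5,6,1,2) True *(4)] *(7) by argo
  next
    case False
    then show ?thesis
      using amicable_sides_ordered[of c d a b] * by auto
  qed
  then show "\<exists>((a, b), (c, d)) \<in> listed_pairs.
               rectangle_by a b R1 \<and> rectangle_by c d R2 \<or>
               rectangle_by a b R2 \<and> rectangle_by c d R1"
  proof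
    assume "(a, b, c, d) \<in> ?list"
    from listed[OF this] show ?thesis
      by (rule bexI[rotated]) (simp add: R)
  next
    assume "(c, d, a, b) \<in> ?list"
    from listed[OF this] show ?thesis
      by (rule bexI[rotated]) (simp add: R)
  qed
qed

end
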